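(* Let $m,k,r,n$ be non-negative integers with $\frac m2\geqslant k\geqslant r\geqslant n\geqslant 0$, and let $C^m_{k,r,n}$ be the dimension of the weight space of weight $(m-2k,\,m-2r,\,m-2n)$ in the $m$-th symmetric power $S^m(\mathbb C^2\otimes\mathbb C^2\otimes\mathbb C^2)$, regarded as a module over $sl_2(\mathbb C)\oplus sl_2(\mathbb C)\oplus sl_2(\mathbb C)$. Then the following hold. (I) If $r+n\leqslant k$, then $$C^{m}_{k,r,n}=1+\frac{4 n}{3}+\frac{n^2}{12}-\frac{n^3}{3}-\frac{n^4}{12}+r+\frac{11 n r}{6}+n^2 r+\frac{n^3 r}{6}.$$ (II) If $k<r+n<m-k$, put $$ \begin{aligned} P=&\frac{k}{3}-\frac{5 k^2}{12}+\frac{k^3}{6}-\frac{k^4}{48}+n+\frac{5 k n}{6}-\frac{k^2 n}{2}+\frac{k^3 n}{12}-\frac{n^2}{3}+\frac{k n^2}{2}-\frac{k^2 n^2}{8}-\frac{n^3}{2}+\frac{k n^3}{12}-\frac{5 n^4}{48}+\frac{2 r}{3}\\ &+\frac{5 k r}{6}-\frac{k^2 r}{2}+\frac{k^3 r}{12}+n r+k n r-\frac{k^2 n r}{4}+\frac{n^2 r}{2}+\frac{k n^2 r}{4}+\frac{n^3 r}{12}-\frac{5 r^2}{12}+\frac{k r^2}{2}-\frac{k^2 r^2}{8}-\frac{n r^2}{2}\\ &+\frac{k n r^2}{4}-\frac{n^2 r^2}{8}-\frac{r^3}{6}+\frac{k r^3}{12}-\frac{n r^3}{12}-\frac{r^4}{48}.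 \end{aligned} $$ (II.1) If $2\mid (r+n-k)$, then $C^m_{k,r,n}=1+P$. (II.2) If $2\nmid (r+n-k)$, then $C^m_{k,r,n}=\frac{15}{16}+P$. (III) If $m-k\leqslant r+n$, put $$ \begin{aligned} Q=&-\frac{5 k^2}{6}-\frac{k^4}{24}+\frac{m}{3}+\frac{5 k m}{6}+\frac{k^2 m}{2}+\frac{k^3 m}{12}-\frac{5 m^2}{12}-\frac{k m^2}{2}-\frac{k^2 m^2}{8}+\frac{m^3}{6}+\frac{k m^3}{12}-\frac{m^4}{48}+\frac{2 n}{3}-k^2 n\\ &+\frac{5 m n}{6}+k m n+\frac{k^2 m n}{4}-\frac{m^2 n}{2}-\frac{k m^2 n}{4}+\frac{m^3 n}{12}-\frac{3 n^2}{4}-\frac{k^2 n^2}{4}+\frac{m n^2}{2}+\frac{k m n^2}{4}-\frac{m^2 n^2}{8}-\frac{2 n^3}{3}\\ &+\frac{m n^3}{12}-\frac{n^4}{8}+\frac{r}{3}-k^2 r+\frac{5 m r}{6}+k m r+\frac{k^2 m r}{4}-\frac{m^2 r}{2}-\frac{k m^2 r}{4}+\frac{m^3 r}{12}+\frac{n r}{6}-\frac{k^2 n r}{2}+m n r\\ &+\frac{k m n r}{2}-\frac{m^2 n r}{4}+\frac{m n^2 r}{4}-\frac{5 r^2}{6}-\frac{k^2 r^2}{4}+\frac{m r^2}{2}+\frac{k m r^2}{4}-\frac{m^2 r^2}{8}-n r^2+\frac{m n r^2}{4}-\frac{n^2 r^2}{4}-\frac{r^3}{3}\\ &+\frac{m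 r^3}{12}-\frac{n r^3}{6}-\frac{r^4}{24}. \end{aligned} $$ (III.1) If $2\mid m$ and $2\mid (r+n-k)$, then $C^m_{k,r,n}=1+Q$. (III.2) If $2\mid m$ and $2\nmid (r+n-k)$, then $C^m_{k,r,n}=\frac78+Q$. (III.3) If $2\nmid m$, then $C^m_{k,r,n}=\frac{15}{16}+Q$.
   Context: $\mathbb C^2$ is the natural $sl_2(\mathbb C)$-module (matrix multiplication on column vectors) with standard basis $x_0=(1,0)^{\mathrm T}$, $x_1=(0,1)^{\mathrm T}$. The Lie algebra $sl_2(\mathbb C)\oplus sl_2(\mathbb C)\oplus sl_2(\mathbb C)$ acts on $\mathbb C^2\otimes\mathbb C^2\otimes\mathbb C^2$ by $(x,y,z)\cdot(v_1\otimes v_2\otimes v_3)=(x\cdot v_1)\otimes v_2\otimes v_3+v_1\otimes(y\cdot v_2)\otimes v_3+v_1\otimes v_2\otimes(z\cdot v_3)$, and on the symmetric power $S^m(\mathbb C^2\otimes\mathbb C^2\otimes\mathbb C^2)$ by derivations (the action induced from the tensor power). Let $H_i$ ($i=1,2,3$) be the element $\begin{pmatrix}1&0\\0&-1\end{pmatrix}$ in the $i$-th copy of $sl_2(\mathbb C)$. The weight space of weight $(\mu_1,\mu_2,\mu_3)$ in a module $M$ is $\{v\in M : H_i\cdot v=\mu_i v\text{ for } i=1,2,3\}$. Equivalently, since $S^m(\mathbb C^2\otimes\mathbb C^2\otimes\mathbb C^2)$ has as basis the degree-$m$ monomials $\prod x_{i,j,l}^{a_{i,j,l}}$ in the eight variables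 $x_{i,j,l}=x_i\otimes x_j\otimes x_l$ ($i,j,l\in\{0,1\}$), where $x_{i,j,l}$ has weight $(1-2i,1-2j,1-2l)$, the number $C^m_{k,r,n}$ is the number of families $(a_{i,j,l})_{i,j,l\in\{0,1\}}$ of non-negative integers satisfying $\sum_{i,j,l}a_{i,j,l}=m$, $\sum_{j,l}a_{1,j,l}=k$, $\sum_{i,l}a_{i,1,l}=r$, $\sum_{i,j}a_{i,j,1}=n$. *)

theory Defs
  imports "HOL-Analysis.Analysis" "HOL-Library.Poly_Mapping"
begin

definition sl2 :: "(complex^2^2) set" where
  "sl2 = {A. trace A = 0}"

text \<open>The formulas for the actions below make sense for arbitrary triples of matrices;
  the Lie algebra in question is \<open>sl2_cubed\<close>, which contains \<open>H1\<close>, \<open>H2\<close>, \<open>H3\<close>.\<close>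

type_synonym mat_triple = "(complex^2^2) \<times> (complex^2^2) \<times> (complex^2^2)"

definition sl2_cubed :: "mat_triple set" where
  "sl2_cubed = sl2 \<times> sl2 \<times> sl2"

definition bracket :: "complex^2^2 \<Rightarrow> complex^2^2 \<Rightarrow> complex^2^2" where
  "bracket A B = A ** B - B ** A"

fun bracket3 :: "mat_triple \<Rightarrow> mat_triple \<Rightarrow> mat_triple" where
  "bracket3 (x, y, z) (x', y', z') = (bracket x x', bracket y y', bracket z z')"

definition sl2_H :: "complex^2^2" where
  "sl2_H = vector [vector [1, 0], vector [0, -1]]"

definition H1 :: "mat_triple" where "H1 = (sl2_H, 0, 0)"
definition H2 :: "mat_triple" where "H2 = (0, sl2_H, 0)"
definition H3 :: "mat_triple" where "H3 = (0, 0, sl2_H)"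

text \<open>The triple tensor power of \<open>\<complex>\<^sup>2\<close> is the space of coordinate arrays indexed by
  \<open>2 \<times> 2 \<times> 2\<close>. The elements of the index type \<open>2\<close> are \<open>1\<close> and \<open>2\<close>, so
  \<open>x\<^sub>0\<close> is \<open>axis 1 1\<close>, \<open>x\<^sub>1\<close> is \<open>axis 2 1\<close>, and
  \<open>x\<^sub>i \<otimes> x\<^sub>j \<otimes> x\<^sub>l\<close> is \<open>axis (i + 1, j + 1, l + 1) 1\<close>.\<close>

type_synonym cube_index = "2 \<times> 2 \<times> 2"
type_synonym cube_tensor = "complex ^ cube_index"

definition tensor3 :: "complex^2 \<Rightarrow> complex^2 \<Rightarrow> complex^2 \<Rightarrow> cube_tensor" where
  "tensor3 u v w = vec_lambda (\<lambda>(i, j, l). u $ i * v $ j * w $ l)"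

fun tensor_act :: "mat_triple \<Rightarrow> cube_tensor \<Rightarrow> cube_tensor" where
  "tensor_act (x, y, z) t = vec_lambda (\<lambda>(i, j, l).
     (\<Sum>a\<in>UNIV. x $ i $ a * t $ (a, j, l)) +
     (\<Sum>b\<in>UNIV. y $ j $ b * t $ (i, b, l)) +
     (\<Sum>c\<in>UNIV. z $ l $ c * t $ (i, j, c)))"

text \<open>The symmetric algebra is the polynomial ring in the eight coordinates, and its
  \<open>m\<close>-th symmetric power consists of the homogeneous polynomials of degree \<open>m\<close>;
  a monomial is its exponent family \<open>cube_index \<Rightarrow>\<^sub>0 nat\<close>.\<close>

type_synonym cube_poly = "(cube_index \<Rightarrow>\<^sub>0 nat) \<Rightarrow>\<^sub>0 complex"

definition sym_scale :: "complex \<Rightarrow> cube_poly \<Rightarrow> cube_poly" where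
  "sym_scale c p = Poly_Mapping.single 0 c * p"

definition sym_power :: "nat \<Rightarrow> cube_poly set" where
  "sym_power m = {p. \<forall>a\<in>Poly_Mapping.keys p. (\<Sum>e\<in>UNIV. Poly_Mapping.lookup a e) = m}"

definition sym_embed :: "cube_tensor \<Rightarrow> cube_poly" where
  "sym_embed t = (\<Sum>e\<in>UNIV. Poly_Mapping.single (Poly_Mapping.single e 1) (t $ e))"

definition partial_deriv :: "cube_index \<Rightarrow> cube_poly \<Rightarrow> cube_poly" where
  "partial_deriv e p = (\<Sum>a\<in>Poly_Mapping.keys p.
     Poly_Mapping.single (a - Poly_Mapping.single e 1)
       (of_nat (Poly_Mapping.lookup a e) * Poly_Mapping.lookup p a))"

text \<open>The derivation of the symmetric algebra extending \<open>tensor_act g\<close>; see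
  \<open>sym_act_embed\<close> and \<open>sym_act_mult\<close> below.\<close>

definition sym_act :: "mat_triple \<Rightarrow> cube_poly \<Rightarrow> cube_poly" where
  "sym_act g p = (\<Sum>e\<in>UNIV. sym_embed (tensor_act g (axis e 1)) * partial_deriv e p)"

definition weight_space :: "nat \<Rightarrow> complex \<Rightarrow> complex \<Rightarrow> complex \<Rightarrow> cube_poly set" where
  "weight_space m \<mu>1 \<mu>2 \<mu>3 = {p \<in> sym_power m.
     sym_act H1 p = sym_scale \<mu>1 p \<and> sym_act H2 p = sym_scale \<mu>2 p \<and> sym_act H3 p = sym_scale \<mu>3 p}"

interpretation sym: vector_space sym_scale
  by unfold_locales
    (simp_all add: sym_scale_def algebra_simps mult_single single_add single_one
      flip: mult.assoc)

definition weight_dim :: "nat \<Rightarrow> nat \<Rightarrow> nat \<Rightarrow> nat \<Rightarrow> nat" where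
  "weight_dim m k r n = vector_space.dim sym_scale (weight_space m
     (of_nat m - 2 * of_nat k) (of_nat m - 2 * of_nat r) (of_nat m - 2 * of_nat n))"

text \<open>The argument order of \<open>P_poly\<close> and \<open>Q_poly\<close> is that of the subscripts \<open>k, r, n\<close>.\<close>

definition P_poly :: "real \<Rightarrow> real \<Rightarrow> real \<Rightarrow> real" where
  "P_poly k r n =
    k / 3 - 5 * k^2 / 12 + k^3 / 6 - k^4 / 48 + n + 5 * k * n / 6 - k^2 * n / 2 + k^3 * n / 12
     - n^2 / 3 + k * n^2 / 2 - k^2 * n^2 / 8 - n^3 / 2 + k * n^3 / 12 - 5 * n^4 / 48
     + 2 * r / 3 + 5 * k * r / 6 - k^2 * r / 2 + k^3 * r / 12 + n * r + k * n * r
     - k^2 * n * r / 4 + n^2 * r / 2 + k * n^2 * r / 4 + n^3 * r / 12 - 5 * r^2 / 12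
     + k * r^2 / 2 - k^2 * r^2 / 8 - n * r^2 / 2 + k * n * r^2 / 4 - n^2 * r^2 / 8 - r^3 / 6
     + k * r^3 / 12 - n * r^3 / 12 - r^4 / 48"

definition Q_poly :: "real \<Rightarrow> real \<Rightarrow> real \<Rightarrow> real \<Rightarrow> real" where
  "Q_poly m k r n =
    - 5 * k^2 / 6 - k^4 / 24 + m / 3 + 5 * k * m / 6 + k^2 * m / 2 + k^3 * m / 12
     - 5 * m^2 / 12 - k * m^2 / 2 - k^2 * m^2 / 8 + m^3 / 6 + k * m^3 / 12 - m^4 / 48
     + 2 * n / 3 - k^2 * n + 5 * m * n / 6 + k * m * n + k^2 * m * n / 4 - m^2 * n / 2
     - k * m^2 * n / 4 + m^3 * n / 12 - 3 * n^2 / 4 - k^2 * n^2 / 4 + m * n^2 / 2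
     + k * m * n^2 / 4 - m^2 * n^2 / 8 - 2 * n^3 / 3 + m * n^3 / 12 - n^4 / 8 + r / 3 - k^2 * r
     + 5 * m * r / 6 + k * m * r + k^2 * m * r / 4 - m^2 * r / 2 - k * m^2 * r / 4
     + m^3 * r / 12 + n * r / 6 - k^2 * n * r / 2 + m * n * r + k * m * n * r / 2
     - m^2 * n * r / 4 + m * n^2 * r / 4 - 5 * r^2 / 6 - k^2 * r^2 / 4 + m * r^2 / 2
     + k * m * r^2 / 4 - m^2 * r^2 / 8 - n * r^2 + m * n * r^2 / 4 - n^2 * r^2 / 4 - r^3 / 3
     + m * r^3 / 12 - n * r^3 / 6 - r^4 / 24"

text \<open>The remaining lemmas show that \<open>tensor_act\<close> satisfies the Leibniz formula on pure tensors, that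
  \<open>sym_act\<close> is the linear derivation extending it, and that it makes each \<open>sym_power m\<close>
  a module.\<close>

lemma H_in_sl2_cubed: "H1 \<in> sl2_cubed" "H2 \<in> sl2_cubed" "H3 \<in> sl2_cubed"
  by (simp_all add: H1_def H2_def H3_def sl2_cubed_def sl2_def sl2_H_def trace_def sum_2)

lemma bracket_in_sl2: "bracket A B \<in> sl2"
  by (simp add: sl2_def bracket_def trace_sub trace_mul_sym[of A B])

lemma bracket3_in_sl2_cubed: "bracket3 g h \<in> sl2_cubed"
  by (cases g; cases h) (simp add: sl2_cubed_def bracket_in_sl2)

lemma tensor_act_tensor3:
  "tensor_act (x, y, z) (tensor3 u v w) =
     tensor3 (x *v u) v w + tensor3 u (y *v v) w + tensor3 u v (z *v w)"
  by (simp add: tensor3_def vec_eq_iff matrix_vector_mult_def sum_distrib_left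
      sum_distrib_right mult_ac)

lemma tensor_act_add: "tensor_act g (s + t) = tensor_act g s + tensor_act g t"
  by (cases g) (simp add: vec_eq_iff sum.distrib algebra_simps)

lemma tensor_act_scale: "tensor_act g (c *s t) = c *s tensor_act g t"
  by (cases g) (simp add: vec_eq_iff sum_distrib_left algebra_simps)

lemma tensor_act_bracket:
  "tensor_act (bracket3 g h) t = tensor_act g (tensor_act h t) - tensor_act h (tensor_act g t)"
proof -
  obtain x y z where g: "g = (x, y, z)" by (cases g)
  obtain x' y' z' where h: "h = (x', y', z')" by (cases h)
  show ?thesis unfolding g h vec_eq_iff split_paired_All
    by (intro allI) (simp add: bracket_def matrix_matrix_mult_def sum_2, algebra)
qed

lemma partial_deriv_superset:
  assumes "finite A" "Poly_Mapping.keys p \<subseteq> A"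
  shows "partial_deriv e p = (\<Sum>a\<in>A. Poly_Mapping.single (a - Poly_Mapping.single e 1)
       (of_nat (Poly_Mapping.lookup a e) * Poly_Mapping.lookup p a))"
  unfolding partial_deriv_def
  by (rule sum.mono_neutral_left) (use assms in \<open>auto simp: in_keys_iff\<close>)

lemma partial_deriv_add: "partial_deriv e (p + q) = partial_deriv e p + partial_deriv e q"
proof -
  let ?A = "Poly_Mapping.keys p \<union> Poly_Mapping.keys q"
  have "Poly_Mapping.keys (p + q) \<subseteq> ?A" by (rule Poly_Mapping.keys_add)
  then show ?thesis
    by (simp add: partial_deriv_superset[of ?A] lookup_add single_add sum.distrib algebra_simps)
qed

lemma partial_deriv_zero: "partial_deriv e 0 = 0"
  by (simp add: partial_deriv_def)

lemma partial_deriv_single: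
  "partial_deriv e (Poly_Mapping.single a c) =
     Poly_Mapping.single (a - Poly_Mapping.single e 1) (of_nat (Poly_Mapping.lookup a e) * c)"
  by (subst partial_deriv_superset[of "{a}"]) auto

lemma partial_deriv_sum: "partial_deriv e (sum f A) = (\<Sum>x\<in>A. partial_deriv e (f x))"
  by (induction A rule: infinite_finite_induct)
    (simp_all add: partial_deriv_add partial_deriv_zero)

lemma cube_poly_induct [case_names zero single add]:
  assumes "P 0" "\<And>a c. P (Poly_Mapping.single a c)" "\<And>p q. P p \<Longrightarrow> P q \<Longrightarrow> P (p + q)"
  shows "P (p :: cube_poly)"
proof (induction p rule: update_induct)
  case const
  then show ?case using assms(1) by simp
next
  case (update p a c)
  have "Poly_Mapping.update a c p = p + Poly_Mapping.single a c"
    using update(1) by (intro poly_mapping_eqI)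
      (auto simp: lookup_update lookup_add lookup_single when_def in_keys_iff)
  then show ?case using assms update by metis
qed

lemma monom_shift:
  assumes "Poly_Mapping.lookup a e \<noteq> (0::nat)"
  shows "a - Poly_Mapping.single e (Suc 0) + b = a + b - Poly_Mapping.single e (Suc 0)"
    and "b + (a - Poly_Mapping.single e (Suc 0)) = b + a - Poly_Mapping.single e (Suc 0)"
  using assms by (auto intro!: poly_mapping_eqI
      simp: lookup_add lookup_minus lookup_single when_def)

lemma partial_deriv_mult:
  "partial_deriv e (p * q) = partial_deriv e p * q + p * partial_deriv e q"
proof (induction p rule: cube_poly_induct)
  case (single a c)
  show ?case
  proof (induction q rule: cube_poly_induct)
    case (single b d)
    show ?case
      by (cases "Poly_Mapping.lookup a e = 0"; cases "Poly_Mapping.lookup b e = 0")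
        (simp_all add: partial_deriv_single mult_single lookup_add monom_shift
          add.commute[of b a] distrib_left distrib_right mult_ac flip: single_add)
  qed (simp_all add: partial_deriv_zero partial_deriv_add algebra_simps)
qed (simp_all add: partial_deriv_zero partial_deriv_add algebra_simps)

lemma partial_deriv_commute:
  "partial_deriv e (partial_deriv f p) = partial_deriv f (partial_deriv e p)"
proof (induction p rule: cube_poly_induct)
  case (single a c)
  show ?case
    by (simp add: partial_deriv_single lookup_minus lookup_single when_def
        diff_diff_add add.commute mult_ac)
qed (simp_all add: partial_deriv_zero partial_deriv_add)

lemma partial_deriv_const: "partial_deriv e (Poly_Mapping.single 0 c) = 0"
  by (simp add: partial_deriv_single)

lemma partial_deriv_embed: "partial_deriv e (sym_embed t) = Poly_Mapping.single 0 (t $ e)"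
proof -
  have "partial_deriv e (sym_embed t) =
      (\<Sum>f\<in>UNIV. if f = e then Poly_Mapping.single 0 (t $ e) else 0)"
    unfolding sym_embed_def partial_deriv_sum
    by (rule sum.cong) (auto simp: partial_deriv_single lookup_single when_def)
  then show ?thesis by simp
qed

lemma sym_embed_add: "sym_embed (s + t) = sym_embed s + sym_embed t"
  by (simp add: sym_embed_def single_add sum.distrib)

lemma sym_embed_diff: "sym_embed (s - t) = sym_embed s - sym_embed t"
  by (simp add: sym_embed_def single_diff sum_subtractf)

lemma sym_embed_zero: "sym_embed 0 = 0"
  by (simp add: sym_embed_def)

lemma sym_embed_sum: "sym_embed (sum f A) = (\<Sum>x\<in>A. sym_embed (f x))"
  by (induction A rule: infinite_finite_induct) (simp_all add: sym_embed_add sym_embed_zero)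

lemma sym_embed_scale: "sym_embed (c *s t) = sym_scale c (sym_embed t)"
  by (simp add: sym_embed_def sym_scale_def sum_distrib_left mult_single)

lemma tensor_expand: "t = (\<Sum>e\<in>UNIV. (t $ e) *s axis e (1::complex))"
  by (simp add: basis_expansion)

lemma sym_embed_tensor_act:
  "sym_embed (tensor_act g t) =
     (\<Sum>e\<in>UNIV. Poly_Mapping.single 0 (t $ e) * sym_embed (tensor_act g (axis e 1)))"
proof -
  have zero: "tensor_act g 0 = 0"
    using tensor_act_scale[of g 0 0] by simp
  have sum: "tensor_act g (sum f A) = (\<Sum>x\<in>A. tensor_act g (f x))"
    for f :: "cube_index \<Rightarrow> cube_tensor" and A
    by (induction A rule: infinite_finite_induct) (simp_all add: tensor_act_add zero)
  have "tensor_act g t = (\<Sum>e\<in>UNIV. (t $ e) *s tensor_act g (axis e 1))"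
    by (subst tensor_expand[of t]) (simp only: sum tensor_act_scale)
  then show ?thesis
    by (simp add: sym_embed_sum sym_embed_scale sym_scale_def)
qed

lemma sym_act_embed: "sym_act g (sym_embed t) = sym_embed (tensor_act g t)"
  by (simp add: sym_act_def partial_deriv_embed sym_embed_tensor_act[of g t] mult.commute)

lemma sym_act_mult: "sym_act g (p * q) = sym_act g p * q + p * sym_act g q"
  by (simp add: sym_act_def partial_deriv_mult sum.distrib sum_distrib_left sum_distrib_right
      algebra_simps)

lemma sym_act_add: "sym_act g (p + q) = sym_act g p + sym_act g q"
  by (simp add: sym_act_def partial_deriv_add sum.distrib algebra_simps)

lemma sym_act_scale: "sym_act g (sym_scale c p) = sym_scale c (sym_act g p)"
  by (simp add: sym_act_def sym_scale_def partial_deriv_mult partial_deriv_const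
      sum_distrib_left mult_ac)

lemma sym_act_bracket:
  "sym_act (bracket3 g h) p = sym_act g (sym_act h p) - sym_act h (sym_act g p)"
proof -
  define L where "L g e = sym_embed (tensor_act g (axis e 1))" for g e
  have act: "sym_act g (sym_act h p) =
      (\<Sum>f\<in>UNIV. sym_embed (tensor_act g (tensor_act h (axis f 1))) * partial_deriv f p) +
      (\<Sum>e\<in>UNIV. \<Sum>f\<in>UNIV. L g e * L h f * partial_deriv e (partial_deriv f p))" for g h
  proof -
    have "sym_act g (sym_act h p) =
        (\<Sum>f\<in>UNIV. sym_act g (L h f) * partial_deriv f p + L h f * sym_act g (partial_deriv f p))"
    proof -
      have "sym_act g (sum F A) = (\<Sum>x\<in>A. sym_act g (F x))" for F and A :: "cube_index set"
        by (induction A rule: infinite_finite_induct)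
          (simp_all add: sym_act_add, simp_all add: sym_act_def partial_deriv_zero)
      then show ?thesis
        by (subst sym_act_def[of h]) (simp add: sym_act_mult L_def)
    qed
    also have "\<dots> = (\<Sum>f\<in>UNIV. sym_act g (L h f) * partial_deriv f p) +
        (\<Sum>f\<in>UNIV. \<Sum>e\<in>UNIV. L g e * L h f * partial_deriv e (partial_deriv f p))"
      by (simp add: sum.distrib sym_act_def[of g "partial_deriv _ p"] sum_distrib_left mult_ac
          flip: L_def)
    finally show ?thesis
      by (subst sum.swap) (simp add: L_def sym_act_embed)
  qed
  have swap: "(\<Sum>e\<in>UNIV. \<Sum>f\<in>UNIV. L g e * L h f * partial_deriv e (partial_deriv f p)) =
      (\<Sum>e\<in>UNIV. \<Sum>f\<in>UNIV. L h e * L g f * partial_deriv e (partial_deriv f p))"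
    by (subst sum.swap) (simp add: partial_deriv_commute mult_ac)
  show ?thesis
    unfolding act swap
    by (simp add: sym_act_def tensor_act_bracket sym_embed_diff algebra_simps sum_subtractf)
qed

lemma sym_act_sym_power:
  assumes "p \<in> sym_power m"
  shows "sym_act g p \<in> sym_power m"
proof -
  define deg where "deg a = (\<Sum>e\<in>UNIV. Poly_Mapping.lookup a e)" for a :: "cube_index \<Rightarrow>\<^sub>0 nat"
  have deg_add: "deg (a + b) = deg a + deg b" for a b
    by (simp add: deg_def lookup_add sum.distrib)
  have deg_single: "deg (Poly_Mapping.single e 1) = 1" for e
    by (simp add: deg_def lookup_single when_def)
  have deg_shift: "deg (a - Poly_Mapping.single e 1) + 1 = deg a"
    if "Poly_Mapping.lookup a e \<noteq> 0" for a e
  proof -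
    have "a = a - Poly_Mapping.single e 1 + Poly_Mapping.single e 1"
      using that by (auto intro!: poly_mapping_eqI simp: lookup_add lookup_minus lookup_single when_def)
    then show ?thesis using deg_add deg_single by metis
  qed
  have deg_embed: "deg b = 1" if "b \<in> Poly_Mapping.keys (sym_embed t)" for b t
    using that deg_single
      Poly_Mapping.keys_sum[of "\<lambda>e. Poly_Mapping.single (Poly_Mapping.single e 1) (t $ e)" UNIV]
    unfolding sym_embed_def by (fastforce split: if_splits)
  have deg_deriv: "deg b + 1 = m" if b: "b \<in> Poly_Mapping.keys (partial_deriv e p)" for b e
  proof -
    from b obtain a where a: "a \<in> Poly_Mapping.keys p"
      and "b \<in> Poly_Mapping.keys (Poly_Mapping.single (a - Poly_Mapping.single e 1)
        (of_nat (Poly_Mapping.lookup a e) * Poly_Mapping.lookup p a))"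
      unfolding partial_deriv_def using Poly_Mapping.keys_sum by fastforce
    then have "b = a - Poly_Mapping.single e 1" "Poly_Mapping.lookup a e \<noteq> 0"
      by (auto split: if_splits)
    with a assms show ?thesis using deg_shift by (auto simp: sym_power_def deg_def)
  qed
  have "deg c = m" if c: "c \<in> Poly_Mapping.keys (sym_act g p)" for c
  proof -
    from c obtain e where "c \<in> Poly_Mapping.keys (sym_embed (tensor_act g (axis e 1)) * partial_deriv e p)"
      unfolding sym_act_def using Poly_Mapping.keys_sum by fastforce
    then obtain a b where "c = a + b" "a \<in> Poly_Mapping.keys (sym_embed (tensor_act g (axis e 1)))"
      "b \<in> Poly_Mapping.keys (partial_deriv e p)"
      using Poly_Mapping.keys_mult by blast
    then show ?thesis using deg_embed deg_deriv deg_add by (metis add.commute)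
  qed
  then show ?thesis by (simp add: sym_power_def deg_def)
qed

end

theory Submission
  imports Defs
begin

text \<open>
  Monomials are weight vectors, so the dimension counts exponent families. These are determined by
  \<open>(s, t, p, q) = (a\<^bsub>011\<^esub>, a\<^bsub>111\<^esub>, a\<^bsub>110\<^esub>, a\<^bsub>101\<^esub>)\<close>; the other four
  exponents only impose inequalities. For \<open>n \<le> r \<le> k \<le> m / 2\<close>, start from the points with
  \<open>a\<^bsub>010\<^esub>, a\<^bsub>001\<^esub> \<ge> 0\<close>. The points violating \<open>a\<^bsub>100\<^esub> \<ge> 0\<close> and those violating
  \<open>a\<^bsub>000\<^esub> \<ge> 0\<close> form disjoint sets, and each is a copy of a corner
  \<open>2 s + t + p + q < d\<close>, with \<open>d = r + n - k\<close> and \<open>d = k + r + n - m\<close> respectively. Hence the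
  dimension is a polynomial in \<open>r\<close> and \<open>n\<close> minus two values of one quasi-polynomial of period 2,
  and the three cases of the theorem record which of the two corners are nonempty.
\<close>

section \<open>Lattice point counts by slicing\<close>

text \<open>Splitting off the slice at \<open>0\<close> and shifting the rest down turns each family
  counted below into itself with a smaller parameter plus a family with one coordinate less. This
  yields all the recurrences.\<close>

lemma card_split_Suc:
  fixes S :: "(nat \<times> 'a) set"
  assumes "finite S"
  shows "card S = card {y. (0, y) \<in> S} + card {(x, y). (Suc x, y) \<in> S}"
proof -
  let ?A = "{y. (0, y) \<in> S}" and ?B = "{(x, y). (Suc x, y) \<in> S}"
  have S: "S = Pair (0::nat) ` ?A \<union> map_prod Suc id ` ?B"
  proof (intro equalityI subsetI)
    fix z assume "z \<in> S"
    moreover obtain x y where "z = (x, y)" by (cases z)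
    ultimately show "z \<in> Pair (0::nat) ` ?A \<union> map_prod Suc id ` ?B"
      by (cases x) (auto simp: image_iff)
  qed auto
  have inj: "inj_on (Pair (0::nat)) ?A" "inj_on (map_prod Suc id) ?B"
    by (auto simp: inj_on_def)
  have "finite (Pair (0::nat) ` ?A \<union> map_prod Suc id ` ?B)"
    using assms S by simp
  note fin = finite_subset[OF Un_upper1 this] finite_subset[OF Un_upper2 this]
  have "card (Pair (0::nat) ` ?A \<union> map_prod Suc id ` ?B)
      = card (Pair (0::nat) ` ?A) + card (map_prod Suc id ` ?B)"
    by (intro card_Un_disjoint fin) auto
  then show ?thesis
    using S inj by (simp add: card_image)
qed

lemma card_pairs_sum_less:
  "2 * card {(p, q). p + q < (d::nat)} = d * (d + 1)"
proof (induction d)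
  case (Suc d)
  have "finite {(p, q). p + q < Suc d}"
    by (rule finite_subset[of _ "{..d} \<times> {..d}"]) auto
  note split = card_split_Suc[OF this]
  have "{q. q < Suc d} = {..<Suc d}" by auto
  then show ?case
    using Suc split by simp
qed simp

lemma card_triples_sum_less:
  "6 * card {(t, p, q). t + p + q < (d::nat)} = d * (d + 1) * (d + 2)"
proof (induction d)
  case (Suc d)
  have "finite {(t, p, q). t + p + q < Suc d}"
    by (rule finite_subset[of _ "{..d} \<times> {..d} \<times> {..d}"]) auto
  note split = card_split_Suc[OF this]
  show ?case
    using Suc split card_pairs_sum_less[of "Suc d"] by (simp add: algebra_simps)
qed simp

definition corner_count :: "nat \<Rightarrow> nat" where
  "corner_count d = card {(s, t, p, q). 2 * s + t + p + q < d}"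

lemma finite_corner: "finite {(s, t, p, q). 2 * s + t + p + q < (d::nat)}"
  by (rule finite_subset[of _ "{..d} \<times> {..d} \<times> {..d} \<times> {..d}"]) auto

lemma corner_count_0: "corner_count 0 = 0"
proof -
  have "{(s, t, p, q). 2 * s + t + p + q < (0::nat)} = {}" by auto
  then show ?thesis by (simp only: corner_count_def card.empty)
qed

text \<open>One unit of \<open>s\<close> uses up two units of \<open>d\<close>, hence the step by
  two; the slice \<open>s = 0\<close> is a tetrahedron.\<close>

lemma corner_count_Suc_Suc:
  "6 * corner_count (Suc (Suc d)) = 6 * corner_count d + (d + 2) * (d + 3) * (d + 4)"
  using card_split_Suc[OF finite_corner[of "Suc (Suc d)"]] card_triples_sum_less[of "Suc (Suc d)"]
  by (simp add: corner_count_def algebra_simps)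

text \<open>The recurrence links \<open>d\<close> only with \<open>d + 2\<close>, so both parity
  classes follow one polynomial up to a constant. That polynomial is 15/16 at \<open>d = 1\<close>,
  where the count is 1; this is the source of the 1/16.\<close>

lemma corner_count_eq:
  "real (corner_count d) = real d / 3 + 5 * real d ^ 2 / 12 + real d ^ 3 / 6 + real d ^ 4 / 48
     + (if even d then 0 else 1 / 16)"
proof (induction d rule: induct_nat_012)
  case 0
  show ?case by (simp add: corner_count_0)
next
  case 1
  have "{(s, t, p, q). 2 * s + t + p + q < Suc 0} = {(0, 0, 0, 0)}" by auto
  then show ?case by (simp add: corner_count_def)
next
  case (ge2 d)
  have "6 * real (corner_count (Suc (Suc d)))
      = 6 * real (corner_count d) + (real d + 2) * (real d + 3) * (real d + 4)"
    using arg_cong[OF corner_count_Suc_Suc[of d], of real] by (simp add: algebra_simps)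
  with ge2(1) show ?case
    by (simp add: field_simps power2_eq_square power3_eq_cube power4_eq_xxxx)
qed

text \<open>The difference \<open>j\<close> of the bounds stays fixed, because shifting
  \<open>t\<close> lowers both by one; the slice \<open>t = 0\<close> is a box. Shifting
  \<open>s\<close> in \<open>bulk_count\<close> works the same way, with the present count as its
  slice.\<close>

lemma card_two_bounds:
  "6 * card {(t, p, q). t + p \<le> n + j \<and> t + q \<le> (n::nat)} = (n + 1) * (n + 2) * (2 * n + 3 * j + 3)"
proof (induction n)
  case 0
  have "{(t, p, q). t + p \<le> j \<and> t + q \<le> (0::nat)} = (\<lambda>p. (0, p, 0)) ` {..j}" by auto
  then show ?case by (simp add: card_image inj_on_def)
next
  case (Suc n)
  have "finite {(t, p, q). t + p \<le> Suc n + j \<and> t + q \<le> Suc n}"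
    by (rule finite_subset[of _ "{..Suc n} \<times> {..Suc n + j} \<times> {..Suc n}"]) auto
  note split = card_split_Suc[OF this]
  have "{(p, q). p \<le> Suc (n + j) \<and> q \<le> Suc n} = {..Suc (n + j)} \<times> {..Suc n}" by auto
  then show ?case
    using Suc split by (simp add: card_cartesian_product algebra_simps)
qed

definition bulk_count :: "nat \<Rightarrow> nat \<Rightarrow> nat" where
  "bulk_count r n = card {(s, t, p, q). s + t + p \<le> r \<and> s + t + q \<le> n}"

lemma finite_bulk: "finite {(s, t, p, q). s + t + p \<le> r \<and> s + t + q \<le> (n::nat)}"
  by (rule finite_subset[of _ "{..n} \<times> {..n} \<times> {..r} \<times> {..n}"]) auto

lemma bulk_count_eq_aux:
  "12 * bulk_count (n + j) n = (n + 1) * (n + 2) * (n + 3) * (n + 2 * j + 2)"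
proof (induction n)
  case 0
  have "{(s, t, p, q). s + t + p \<le> j \<and> s + t + q \<le> (0::nat)} = (\<lambda>p. (0, 0, p, 0)) ` {..j}" by auto
  then show ?case by (simp add: bulk_count_def card_image inj_on_def)
next
  case (Suc n)
  show ?case
    using Suc card_split_Suc[OF finite_bulk[of "Suc n + j" "Suc n"]] card_two_bounds[of "Suc n" j]
    by (simp add: bulk_count_def algebra_simps)
qed

lemma bulk_count_eq:
  assumes "n \<le> r"
  shows "12 * real (bulk_count r n)
    = (real n + 1) * (real n + 2) * (real n + 3) * (2 * real r - real n + 2)"
proof -
  obtain j where r: "r = n + j" using assms le_Suc_ex by blast
  show ?thesis
    using arg_cong[OF bulk_count_eq_aux[of n j], of real] by (simp add: r algebra_simps)
qed

section \<open>Removing two corners from the bulk\<close>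

text \<open>Besides the two bulk bounds, which are a010, a001 \<ge> 0, the first inequality is a100
  \<ge> 0 and the last is a000 \<ge> 0, with terms moved across to avoid truncated
  subtraction.\<close>

definition weight_points :: "nat \<Rightarrow> nat \<Rightarrow> nat \<Rightarrow> nat \<Rightarrow> (nat \<times> nat \<times> nat \<times> nat) set" where
  "weight_points m k r n = {(s, t, p, q). t + p + q \<le> k \<and> s + t + p \<le> r \<and> s + t + q \<le> n \<and>
     k + r + n \<le> m + (s + 2 * t + p + q)}"

text \<open>Truncated subtraction sends a negative corner size to \<open>0\<close>, whose corner is
  empty, so one identity serves all three cases.\<close>

lemma card_weight_points:
  assumes "2 * k \<le> m" "r \<le> k" "n \<le> r"
  shows "card (weight_points m k r n) + corner_count (r + n - k) + corner_count (k + r + n - m)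
    = bulk_count r n"
proof -
  define X where "X = {(s, t, p, q). s + t + p \<le> r \<and> s + t + q \<le> n}"
  define Y where "Y = {(s, t, p, q). s + t + p \<le> r \<and> s + t + q \<le> n \<and> k < t + p + q}"
  define Z where "Z = {(s, t, p, q). s + 2 * t + p + q < k + r + n - m}"
  have fin: "finite X" unfolding X_def by (rule finite_bulk)
  \<comment> \<open>Since \<open>k + n \<le> m\<close> and \<open>k + r \<le> m\<close>, the bound
    defining \<open>Z\<close> exceeds neither \<open>r\<close> nor \<open>n\<close>.\<close>
  have ZX: "Z \<subseteq> X" using assms by (auto simp: X_def Z_def)
  have YX: "Y \<subseteq> X" by (auto simp: X_def Y_def)
  \<comment> \<open>A common point would give
    \<open>k < t + p + q \<le> s + 2 * t + p + q < k + r + n - m\<close>, although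
    \<open>r + n \<le> m\<close>.\<close>
  have YZ: "Y \<inter> Z = {}" using assms by (auto simp: Y_def Z_def)
  have W: "weight_points m k r n = X - (Y \<union> Z)"
    using assms by (auto simp: weight_points_def X_def Y_def Z_def)
  \<comment> \<open>Replacing \<open>p\<close> and \<open>q\<close> by the slacks \<open>a\<^bsub>010\<^esub>\<close> and \<open>a\<^bsub>001\<^esub>\<close> turns \<open>Y\<close> into a corner.\<close>
  have "bij_betw (\<lambda>(s, t, p, q). (s, t, r - s - t - p, n - s - t - q)) Y
      {(s, t, p, q). 2 * s + t + p + q < r + n - k}"
    by (rule bij_betw_byWitness[where f' = "\<lambda>(s, t, p, q). (s, t, r - s - t - p, n - s - t - q)"])
      (use assms in \<open>auto simp: Y_def\<close>)
  then have cY: "card Y = corner_count (r + n - k)"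
    unfolding corner_count_def by (rule bij_betw_same_card)
  \<comment> \<open>In \<open>Z\<close> the coordinate of weight two is \<open>t\<close>, hence the
    swap.\<close>
  have "bij_betw (\<lambda>(s, t, p, q). (t, s, p, q)) Z
      {(s, t, p, q). 2 * s + t + p + q < k + r + n - m}"
    by (rule bij_betw_byWitness[where f' = "\<lambda>(s, t, p, q). (t, s, p, q)"]) (auto simp: Z_def)
  then have cZ: "card Z = corner_count (k + r + n - m)"
    unfolding corner_count_def by (rule bij_betw_same_card)
  have "card (Y \<union> Z) = card Y + card Z"
    using fin YX ZX YZ by (intro card_Un_disjoint) (auto intro: finite_subset)
  moreover have "card (X - (Y \<union> Z)) + card (Y \<union> Z) = card X"
    using fin YX ZX card_mono[of X "Y \<union> Z"] by (subst card_Diff_subset) (auto intro: finite_subset)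
  ultimately show ?thesis
    by (simp add: W cY cZ bulk_count_def flip: X_def)
qed

section \<open>Diagonal action on monomials\<close>

lemma lookup_sym_scale: "Poly_Mapping.lookup (sym_scale c p) a = c * Poly_Mapping.lookup p a"
  by (induction p rule: cube_poly_induct)
    (simp_all add: sym_scale_def mult_single lookup_single when_def lookup_add distrib_left)

text \<open>For diagonal \<open>g\<close> the derivation is a weighted Euler operator, the sum over
  \<open>e\<close> of \<open>w e\<close> times x_e d/dx_e, and every monomial is an
  eigenvector.\<close>

lemma lookup_sym_act_diagonal:
  assumes "\<And>e. tensor_act g (axis e 1) = w e *s axis e 1"
  shows "Poly_Mapping.lookup (sym_act g p) a
    = (\<Sum>e\<in>UNIV. w e * of_nat (Poly_Mapping.lookup a e)) * Poly_Mapping.lookup p a"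
proof (induction p rule: cube_poly_induct)
  case zero
  show ?case by (simp add: sym_act_def partial_deriv_zero)
next
  case (add p q)
  then show ?case by (simp add: sym_act_add lookup_add distrib_left)
next
  case (single b c)
  have emb: "sym_embed (tensor_act g (axis e 1)) = Poly_Mapping.single (Poly_Mapping.single e 1) (w e)"
    for e
  proof -
    have "sym_embed (axis e 1) =
        (\<Sum>f\<in>UNIV. if f = e then Poly_Mapping.single (Poly_Mapping.single e 1) 1 else 0)"
      unfolding sym_embed_def by (rule sum.cong) (auto simp: axis_def)
    then show ?thesis
      by (simp add: assms sym_embed_scale sym_scale_def mult_single)
  qed
  \<comment> \<open>Subtraction of exponents is truncated; where the exponent at \<open>e\<close> is
    zero, the coefficient produced by the derivative kills the term.\<close>
  have "Poly_Mapping.single e 1 + (b - Poly_Mapping.single e 1) = b"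
    if "Poly_Mapping.lookup b e \<noteq> 0" for e
    using that
    by (auto intro!: poly_mapping_eqI simp: lookup_add lookup_minus lookup_single when_def)
  then have "sym_embed (tensor_act g (axis e 1)) * partial_deriv e (Poly_Mapping.single b c)
      = Poly_Mapping.single b (w e * of_nat (Poly_Mapping.lookup b e) * c)" for e
    by (cases "Poly_Mapping.lookup b e = 0")
      (simp_all add: emb partial_deriv_single mult_single mult_ac)
  then have "sym_act g (Poly_Mapping.single b c)
      = (\<Sum>e\<in>UNIV. Poly_Mapping.single b (w e * of_nat (Poly_Mapping.lookup b e) * c))"
    by (simp add: sym_act_def)
  then show ?case
    by (simp add: lookup_sum lookup_single when_def sum_distrib_right)
qed

lemma sym_act_eq_scale_iff:
  assumes "\<And>e. tensor_act g (axis e 1) = w e *s axis e 1"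
  shows "sym_act g p = sym_scale \<mu> p \<longleftrightarrow>
    (\<forall>a\<in>Poly_Mapping.keys p. (\<Sum>e\<in>UNIV. w e * of_nat (Poly_Mapping.lookup a e)) = \<mu>)"
  by (auto simp: poly_mapping_eq_iff fun_eq_iff lookup_sym_act_diagonal[OF assms]
      lookup_sym_scale in_keys_iff)

lemma dim_monomials:
  assumes "finite A"
  shows "sym.dim {p. Poly_Mapping.keys p \<subseteq> A} = card A"
proof (rule sym.dim_unique)
  let ?x = "\<lambda>a. Poly_Mapping.single a (1::complex)"
  have inj: "inj_on ?x A"
    by (rule inj_onI) (metis keys_single singleton_inject zero_neq_one)
  \<comment> \<open>Reading off coefficients serves both spanning and independence.\<close>
  have lookup: "Poly_Mapping.lookup (\<Sum>a\<in>A. sym_scale (f a) (?x a)) b = (if b \<in> A then f b else 0)"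
    for f b
  proof -
    have "Poly_Mapping.lookup (\<Sum>a\<in>A. sym_scale (f a) (?x a)) b
        = (\<Sum>a\<in>A. if a = b then f b else 0)"
      unfolding lookup_sum by (rule sum.cong) (auto simp: lookup_sym_scale lookup_single when_def)
    then show ?thesis using assms by simp
  qed
  show "?x ` A \<subseteq> {p. Poly_Mapping.keys p \<subseteq> A}" by auto
  show "card (?x ` A) = card A" by (rule card_image[OF inj])
  show "{p. Poly_Mapping.keys p \<subseteq> A} \<subseteq> sym.span (?x ` A)"
  proof
    fix p :: cube_poly assume "p \<in> {p. Poly_Mapping.keys p \<subseteq> A}"
    then have "p = (\<Sum>a\<in>A. sym_scale (Poly_Mapping.lookup p a) (?x a))"
      by (intro poly_mapping_eqI) (auto simp: lookup in_keys_iff)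
    moreover have "(\<Sum>a\<in>A. sym_scale (Poly_Mapping.lookup p a) (?x a)) \<in> sym.span (?x ` A)"
      by (intro sym.span_sum sym.span_scale sym.span_base) auto
    ultimately show "p \<in> sym.span (?x ` A)" by simp
  qed
  show "sym.independent (?x ` A)"
  proof (rule sym.independent_if_scalars_zero)
    fix f x assume 0: "(\<Sum>x\<in>?x ` A. sym_scale (f x) x) = 0" and "x \<in> ?x ` A"
    then obtain a where a: "a \<in> A" "x = ?x a" by blast
    have "(\<Sum>a\<in>A. sym_scale (f (?x a)) (?x a)) = 0"
      using 0 by (simp add: sum.reindex[OF inj])
    then show "f x = 0"
      using lookup[of "\<lambda>a. f (?x a)" a] a by simp
  qed (use assms in simp)
qed

section \<open>Weight spaces and exponent families\<close>

lemma sum_cube_index: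
  fixes f :: "cube_index \<Rightarrow> 'a::comm_monoid_add"
  shows "(\<Sum>e\<in>UNIV. f e) = f (1, 1, 1) + f (1, 1, 2) + f (1, 2, 1) + f (1, 2, 2)
    + f (2, 1, 1) + f (2, 1, 2) + f (2, 2, 1) + f (2, 2, 2)"
proof -
  have "(\<Sum>e\<in>UNIV. f e) = (\<Sum>i\<in>UNIV. \<Sum>j\<in>UNIV. \<Sum>l\<in>UNIV. f (i, j, l))"
    by (simp add: sum.cartesian_product flip: UNIV_Times_UNIV)
  then show ?thesis by (simp add: sum_2 add_ac)
qed

text \<open>The weight of a basis vector under \<open>sl2_H\<close>: index \<open>1\<close> stands
  for x_0, index \<open>2\<close> for x_1.\<close>

definition sgn2 :: "2 \<Rightarrow> complex" where "sgn2 i = (if i = 1 then 1 else - 1)"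

lemma tensor_act_H_axis:
  "tensor_act H1 (axis e 1) = (case e of (i, j, l) \<Rightarrow> sgn2 i) *s axis e 1"
  "tensor_act H2 (axis e 1) = (case e of (i, j, l) \<Rightarrow> sgn2 j) *s axis e 1"
  "tensor_act H3 (axis e 1) = (case e of (i, j, l) \<Rightarrow> sgn2 l) *s axis e 1"
proof -
  obtain i j l where e: "e = (i, j, l)" by (cases e)
  show "tensor_act H1 (axis e 1) = (case e of (i, j, l) \<Rightarrow> sgn2 i) *s axis e 1"
    "tensor_act H2 (axis e 1) = (case e of (i, j, l) \<Rightarrow> sgn2 j) *s axis e 1"
    "tensor_act H3 (axis e 1) = (case e of (i, j, l) \<Rightarrow> sgn2 l) *s axis e 1"
    using exhaust_2[of i] exhaust_2[of j] exhaust_2[of l]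
    by (auto simp: e H1_def H2_def H3_def sl2_H_def vec_eq_iff sum_2 axis_def sgn2_def forall_2)
qed

definition weight_exponents :: "nat \<Rightarrow> nat \<Rightarrow> nat \<Rightarrow> nat \<Rightarrow> (cube_index \<Rightarrow>\<^sub>0 nat) set" where
  "weight_exponents m k r n = {a. (\<Sum>e\<in>UNIV. Poly_Mapping.lookup a e) = m \<and>
     (\<Sum>j\<in>UNIV. \<Sum>l\<in>UNIV. Poly_Mapping.lookup a (2, j, l)) = k \<and>
     (\<Sum>i\<in>UNIV. \<Sum>l\<in>UNIV. Poly_Mapping.lookup a (i, 2, l)) = r \<and>
     (\<Sum>i\<in>UNIV. \<Sum>j\<in>UNIV. Poly_Mapping.lookup a (i, j, 2)) = n}"

text \<open>Meant for \<open>x\<close> and \<open>y\<close> the total exponents of the variables of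
  weight 1 and -1 under one \<open>H\<close>; their difference is the eigenvalue of the
  monomial.\<close>

lemma of_nat_weight_iff:
  fixes m x y k :: nat
  assumes "m = x + y"
  shows "(of_nat x - of_nat y :: complex) = of_nat m - 2 * of_nat k \<longleftrightarrow> y = k"
proof -
  have "(of_nat x - of_nat y :: complex) = of_nat m - 2 * of_nat k \<longleftrightarrow> (of_nat y :: complex) = of_nat k"
    using assms by (auto simp: algebra_simps)
  then show ?thesis by simp
qed

lemma weight_space_eq:
  "weight_space m (of_nat m - 2 * of_nat k) (of_nat m - 2 * of_nat r) (of_nat m - 2 * of_nat n)
    = {p. Poly_Mapping.keys p \<subseteq> weight_exponents m k r n}"
proof -
  note act = tensor_act_H_axis[THEN sym_act_eq_scale_iff]
  have iff: "a \<in> weight_exponents m k r n \<longleftrightarrow> (\<Sum>e\<in>UNIV. Poly_Mapping.lookup a e) = m \<and>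
      (\<Sum>e\<in>UNIV. (case e of (i, j, l) \<Rightarrow> sgn2 i) * of_nat (Poly_Mapping.lookup a e)) = of_nat m - 2 * of_nat k \<and>
      (\<Sum>e\<in>UNIV. (case e of (i, j, l) \<Rightarrow> sgn2 j) * of_nat (Poly_Mapping.lookup a e)) = of_nat m - 2 * of_nat r \<and>
      (\<Sum>e\<in>UNIV. (case e of (i, j, l) \<Rightarrow> sgn2 l) * of_nat (Poly_Mapping.lookup a e)) = of_nat m - 2 * of_nat n"
    (is "_ \<longleftrightarrow> ?m \<and> ?k \<and> ?r \<and> ?n") for a
  \<comment> \<open>Both sides demand degree \<open>m\<close>, and only under this condition does an
    eigenvalue determine a partial degree.\<close>
  proof (cases ?m)
    case True
    let ?a = "\<lambda>i j l. Poly_Mapping.lookup a (i, j, l)"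
    have m: "m = ?a 1 1 1 + ?a 1 1 2 + ?a 1 2 1 + ?a 1 2 2 + ?a 2 1 1 + ?a 2 1 2 + ?a 2 2 1 + ?a 2 2 2"
      using True by (simp add: sum_cube_index)
    have k: "?k \<longleftrightarrow> ?a 2 1 1 + ?a 2 1 2 + ?a 2 2 1 + ?a 2 2 2 = k"
      using of_nat_weight_iff[of m "?a 1 1 1 + ?a 1 1 2 + ?a 1 2 1 + ?a 1 2 2"
          "?a 2 1 1 + ?a 2 1 2 + ?a 2 2 1 + ?a 2 2 2" k] m
      by (simp add: sum_cube_index sgn2_def algebra_simps)
    have r: "?r \<longleftrightarrow> ?a 1 2 1 + ?a 1 2 2 + ?a 2 2 1 + ?a 2 2 2 = r"
      using of_nat_weight_iff[of m "?a 1 1 1 + ?a 1 1 2 + ?a 2 1 1 + ?a 2 1 2"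
          "?a 1 2 1 + ?a 1 2 2 + ?a 2 2 1 + ?a 2 2 2" r] m
      by (simp add: sum_cube_index sgn2_def algebra_simps)
    have n: "?n \<longleftrightarrow> ?a 1 1 2 + ?a 1 2 2 + ?a 2 1 2 + ?a 2 2 2 = n"
      using of_nat_weight_iff[of m "?a 1 1 1 + ?a 1 2 1 + ?a 2 1 1 + ?a 2 2 1"
          "?a 1 1 2 + ?a 1 2 2 + ?a 2 1 2 + ?a 2 2 2" n] m
      by (simp add: sum_cube_index sgn2_def algebra_simps)
    show ?thesis
      unfolding k r n using True by (simp add: weight_exponents_def sum_2 add_ac)
  qed (simp add: weight_exponents_def)
  show ?thesis
    unfolding weight_space_def sym_power_def act subset_iff iff by blast
qed

lemma bij_betw_weight_exponents:
  "bij_betw (\<lambda>a. (Poly_Mapping.lookup a (1, 2, 2), Poly_Mapping.lookup a (2, 2, 2),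
      Poly_Mapping.lookup a (2, 2, 1), Poly_Mapping.lookup a (2, 1, 2)))
    (weight_exponents m k r n) (weight_points m k r n)"
  (is "bij_betw ?f _ _")
proof (rule bij_betw_imageI)
  show "inj_on ?f (weight_exponents m k r n)"
  proof (rule inj_onI)
    fix a b assume "a \<in> weight_exponents m k r n" "b \<in> weight_exponents m k r n" "?f a = ?f b"
    then have "Poly_Mapping.lookup a (i, j, l) = Poly_Mapping.lookup b (i, j, l)" for i j l
      using exhaust_2[of i] exhaust_2[of j] exhaust_2[of l]
      by (auto simp: weight_exponents_def sum_cube_index sum_2)
    then show "a = b" by (intro poly_mapping_eqI) auto
  qed
  show "?f ` weight_exponents m k r n = weight_points m k r n"
  proof (intro equalityI subsetI)
    fix x assume "x \<in> ?f ` weight_exponents m k r n"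
    then show "x \<in> weight_points m k r n"
      by (auto simp: weight_exponents_def weight_points_def sum_cube_index sum_2)
  next
    fix x assume x: "x \<in> weight_points m k r n"
    obtain s t p q where stpq: "x = (s, t, p, q)" by (cases x)
    \<comment> \<open>The last four exponents are prescribed; the first four solve the degree
      equations, and the inequalities of \<open>weight_points\<close> make their subtractions
      exact.\<close>
    define a :: "cube_index \<Rightarrow>\<^sub>0 nat" where
      "a = Poly_Mapping.single (1, 1, 1) (m + (s + 2 * t + p + q) - (k + r + n))
        + Poly_Mapping.single (2, 1, 1) (k - (t + p + q))
        + Poly_Mapping.single (1, 2, 1) (r - (s + t + p))
        + Poly_Mapping.single (1, 1, 2) (n - (s + t + q))
        + Poly_Mapping.single (1, 2, 2) s + Poly_Mapping.single (2, 2, 2) t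
        + Poly_Mapping.single (2, 2, 1) p + Poly_Mapping.single (2, 1, 2) q"
    have "a \<in> weight_exponents m k r n" "?f a = x"
      using x by (auto simp: stpq weight_points_def weight_exponents_def sum_cube_index sum_2
          a_def lookup_add lookup_single when_def)
    then show "x \<in> ?f ` weight_exponents m k r n" by blast
  qed
qed

lemma weight_dim_eq_card: "weight_dim m k r n = card (weight_points m k r n)"
proof -
  have "finite (weight_points m k r n)"
    by (rule finite_subset[OF _ finite_bulk[of r n]]) (auto simp: weight_points_def)
  then have "finite (weight_exponents m k r n)"
    using bij_betw_finite[OF bij_betw_weight_exponents] by blast
  then show ?thesis
    unfolding weight_dim_def weight_space_eq
    using dim_monomials bij_betw_same_card[OF bij_betw_weight_exponents] by simp
qed

section \<open>Assembling the cases by which corners are nonempty\<close>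

theorem proposition4p1:
  fixes m k r n :: nat
  assumes "real k \<le> real m / 2" and "r \<le> k" and "n \<le> r"
  shows
    "(r + n \<le> k \<longrightarrow>
        real (weight_dim m k r n) =
          1 + 4 * real n / 3 + real n ^ 2 / 12 - real n ^ 3 / 3 - real n ^ 4 / 12 + real r
          + 11 * real n * real r / 6 + real n ^ 2 * real r + real n ^ 3 * real r / 6) \<and>
     (int k < int r + int n \<and> int r + int n < int m - int k \<longrightarrow>
        (2 dvd (int r + int n - int k) \<longrightarrow>
          real (weight_dim m k r n) = 1 + P_poly (real k) (real r) (real n)) \<and>
        (\<not> 2 dvd (int r + int n - int k) \<longrightarrow>
          real (weight_dim m k r n) = 15 / 16 + P_poly (real k) (real r) (real n))) \<and>
     (int m - int k \<le> int r + int n \<longrightarrow>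
        (2 dvd m \<and> 2 dvd (int r + int n - int k) \<longrightarrow>
          real (weight_dim m k r n) = 1 + Q_poly (real m) (real k) (real r) (real n)) \<and>
        (2 dvd m \<and> \<not> 2 dvd (int r + int n - int k) \<longrightarrow>
          real (weight_dim m k r n) = 7 / 8 + Q_poly (real m) (real k) (real r) (real n)) \<and>
        (\<not> 2 dvd m \<longrightarrow>
          real (weight_dim m k r n) = 15 / 16 + Q_poly (real m) (real k) (real r) (real n)))"
proof -
  define d where "d = r + n - k"
  define d' where "d' = k + r + n - m"
  have km: "2 * k \<le> m" using assms(1) by linarith
  have dim: "real (weight_dim m k r n)
      = real (bulk_count r n) - real (corner_count d) - real (corner_count d')"
    using arg_cong[OF card_weight_points[OF km assms(2,3)], of real]
    by (simp add: weight_dim_eq_card d_def d'_def)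
  have bulk: "real (bulk_count r n)
      = (real n + 1) * (real n + 2) * (real n + 3) * (2 * real r - real n + 2) / 12"
    using bulk_count_eq[OF assms(3)] by simp
  have P: "real (weight_dim m k r n)
      = 1 + P_poly (real k) (real r) (real n) - (if even d then 0 else 1 / 16)"
    if "k \<le> r + n" "r + n \<le> m - k"
  proof -
    have d: "real d = real r + real n - real k" "d' = 0"
      using that km by (auto simp: d_def d'_def)
    show ?thesis
      unfolding dim bulk d(2) corner_count_0 corner_count_eq[of d] d(1) P_poly_def
      by (cases "even d"; simp add: field_simps power2_eq_square power3_eq_cube power4_eq_xxxx)
  qed
  \<comment> \<open>Each corner of odd size lowers the constant by 1/16, which explains 15/16 and
    7/8.\<close>
  have Q: "real (weight_dim m k r n)
      = 1 + Q_poly (real m) (real k) (real r) (real n)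
        - (if even d then 0 else 1 / 16) - (if even d' then 0 else 1 / 16)"
    if "m - k \<le> r + n"
  proof -
    have d: "real d = real r + real n - real k" "real d' = real k + real r + real n - real m"
      using that km by (auto simp: d_def d'_def)
    show ?thesis
      unfolding dim bulk corner_count_eq d Q_poly_def
      by (cases "even d"; cases "even d'"; simp add: field_simps power2_eq_square power3_eq_cube power4_eq_xxxx)
  qed
  have par: "2 dvd int r + int n - int k \<longleftrightarrow> even d" if "k \<le> r + n"
  proof -
    have "int d = int r + int n - int k" using that by (simp add: d_def)
    then show ?thesis by (metis even_of_nat)
  qed
  \<comment> \<open>For even \<open>m\<close> the two corrections occur together or not at all; for
    odd \<open>m\<close> exactly one occurs, so the parity of \<open>d\<close> no longer
    matters.\<close>
  have par': "even d' \<longleftrightarrow> (even d \<longleftrightarrow> even m)" if "m - k \<le> r + n"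
  proof -
    have "d' + m = d + 2 * k" using that km by (auto simp: d_def d'_def)
    then have "even (d' + m) \<longleftrightarrow> even d" by simp
    then show ?thesis by auto
  qed
  have I: "real (weight_dim m k r n) =
      1 + 4 * real n / 3 + real n ^ 2 / 12 - real n ^ 3 / 3 - real n ^ 4 / 12 + real r
      + 11 * real n * real r / 6 + real n ^ 2 * real r + real n ^ 3 * real r / 6"
    if "r + n \<le> k"
  proof -
    have "d = 0" "d' = 0" using that km by (auto simp: d_def d'_def)
    then show ?thesis
      by (simp add: dim bulk corner_count_0 field_simps power2_eq_square power3_eq_cube power4_eq_xxxx)
  qed
  have II: "real (weight_dim m k r n)
      = (if 2 dvd int r + int n - int k then 1 else 15 / 16) + P_poly (real k) (real r) (real n)"
    if "int k < int r + int n" "int r + int n < int m - int k"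
    using P par that by auto
  have III: "real (weight_dim m k r n)
      = (if even m then if 2 dvd int r + int n - int k then 1 else 7 / 8 else 15 / 16)
        + Q_poly (real m) (real k) (real r) (real n)"
    if "int m - int k \<le> int r + int n"
  proof -
    have "m - k \<le> r + n" "k \<le> r + n" using that km by auto
    then show ?thesis using Q par par' by auto
  qed
  show ?thesis
    using I II III by (intro conjI impI) (simp_all split: if_splits)
qed

end
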